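(* Let $n\in\mathbb{N}$ and let $T$ be a linear closable operator on a complex Hilbert space $H$ such that $T^n$ is densely defined. Let $p(z)$ be a complex polynomial of degree $n$. If $\sigma[p(T)]\neq\mathbb{C}$, then $[p(T)]^*=\overline{p}(T^* )$.
   Context: All operators are linear and possibly unbounded, with domain $D(\cdot)\subset H$. $\mathbb{N}=\{1,2,\dots\}$. Sums and products carry their natural domains: $D(A+B)=D(A)\cap D(B)$, $D(AB)=\{x\in D(B):Bx\in D(A)\}$; in particular $D[p(T)]=D(T^n)$. Equality of operators includes equality of domains. If $p(z)=a_nz^n+\cdots+a_1z+a_0$, then $\overline{p}(z)=\overline{a_n}z^n+\cdots+\overline{a_1}z+\overline{a_0}$. The resolvent set of an operator $A$ (not assumed closed) is $\rho(A)=\{\lambda\in\mathbb{C}:\lambda I-A \text{ is bijective from } D(A) \text{ onto } H \text{ and } (\lambda I-A)^{-1}\in B(H)\}$, where $B(H)$ is the set of bounded everywhere defined operators, and $\sigma(A)=\mathbb{C}\setminus\rho(A)$; thus $\sigma(A)=\mathbb{C}$ when $A$ is not closed. *)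

theory Defs
  imports "HOL-Analysis.Analysis" "HOL-Computational_Algebra.Polynomial"
begin

text \<open>A complex inner product space is built on top of the library's class of real inner product
  spaces, so that the norm and the topology are the ones of the library. The complex inner product
  is linear in its first argument. Definiteness, and \<open>norm x = sqrt (Re (cinner x x))\<close>, come from
  \<open>real_inner\<close> by way of \<open>inner_eq_Re_cinner\<close>.\<close>

class complex_inner = real_inner +
  fixes scaleC :: "complex \<Rightarrow> 'a \<Rightarrow> 'a"  (infixr "*\<^sub>C" 75)
    and cinner :: "'a \<Rightarrow> 'a \<Rightarrow> complex"
  assumes scaleC_add_right: "c *\<^sub>C (x + y) = c *\<^sub>C x + c *\<^sub>C y"
    and scaleC_add_left: "(c + d) *\<^sub>C x = c *\<^sub>C x + d *\<^sub>C x"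
    and scaleC_scaleC: "c *\<^sub>C d *\<^sub>C x = (c * d) *\<^sub>C x"
    and scaleR_eq_scaleC: "scaleR r x = complex_of_real r *\<^sub>C x"
    and cinner_commute: "cinner x y = cnj (cinner y x)"
    and cinner_add_left: "cinner (x + y) z = cinner x z + cinner y z"
    and cinner_scaleC_left: "cinner (c *\<^sub>C x) y = c * cinner x y"
    and inner_eq_Re_cinner: "inner x y = Re (cinner x y)"

class chilbert_space = complex_inner + complete_space

instantiation complex :: chilbert_space
begin
definition scaleC_complex :: "complex \<Rightarrow> complex \<Rightarrow> complex" where "scaleC_complex c x = c * x"
definition cinner_complex :: "complex \<Rightarrow> complex \<Rightarrow> complex" where "cinner_complex x y = x * cnj y"
instance
  by standard
    (auto simp: scaleC_complex_def cinner_complex_def inner_complex_def algebra_simps scaleR_conv_of_real)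
end

text \<open>An operator with domain \<open>D(A) \<subseteq> H\<close> is a partial map, with \<open>dom A\<close> as \<open>D(A)\<close>; equality of
  partial maps thus includes equality of domains. The identity is \<open>Some\<close>, and the product with
  its natural domain is \<open>A \<circ>\<^sub>m B\<close>.\<close>

type_synonym 'a operator = "'a \<rightharpoonup> 'a"

definition op_linear :: "'a::complex_inner operator \<Rightarrow> bool" where
  "op_linear A \<longleftrightarrow> 0 \<in> dom A \<and>
     (\<forall>x\<in>dom A. \<forall>y\<in>dom A. A (x + y) = Some (the (A x) + the (A y))) \<and>
     (\<forall>c. \<forall>x\<in>dom A. A (c *\<^sub>C x) = Some (c *\<^sub>C the (A x)))"

definition op_add :: "'a::complex_inner operator \<Rightarrow> 'a operator \<Rightarrow> 'a operator" where
  "op_add A B = (\<lambda>x. if x \<in> dom A \<inter> dom B then Some (the (A x) + the (B x)) else None)"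

text \<open>\<open>D(cA) = D(A)\<close>, also for \<open>c = 0\<close>.\<close>

definition op_scale :: "complex \<Rightarrow> 'a::complex_inner operator \<Rightarrow> 'a operator" where
  "op_scale c A = (\<lambda>x. map_option (\<lambda>y. c *\<^sub>C y) (A x))"

primrec op_power :: "'a::complex_inner operator \<Rightarrow> nat \<Rightarrow> 'a operator" where
  "op_power A 0 = Some"
| "op_power A (Suc k) = A \<circ>\<^sub>m op_power A k"

primrec op_poly_upto :: "complex poly \<Rightarrow> 'a::complex_inner operator \<Rightarrow> nat \<Rightarrow> 'a operator" where
  "op_poly_upto p A 0 = op_scale (coeff p 0) (op_power A 0)"
| "op_poly_upto p A (Suc k) =
     op_add (op_scale (coeff p (Suc k)) (op_power A (Suc k))) (op_poly_upto p A k)"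

definition op_poly :: "complex poly \<Rightarrow> 'a::complex_inner operator \<Rightarrow> 'a operator" where
  "op_poly p A = op_poly_upto p A (degree p)"

definition densely_defined :: "'a::complex_inner operator \<Rightarrow> bool" where
  "densely_defined A \<longleftrightarrow> closure (dom A) = UNIV"

definition op_closed :: "'a::complex_inner operator \<Rightarrow> bool" where
  "op_closed A \<longleftrightarrow> closed (Map.graph A)"

definition op_closable :: "'a::complex_inner operator \<Rightarrow> bool" where
  "op_closable A \<longleftrightarrow> (\<exists>B. op_linear B \<and> op_closed B \<and> A \<subseteq>\<^sub>m B)"

text \<open>The adjoint is meaningful for densely defined \<open>A\<close> only: then the vector \<open>z\<close> is unique.\<close>

definition op_adjoint :: "'a::complex_inner operator \<Rightarrow> 'a operator" where
  "op_adjoint A = (\<lambda>y.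
     if \<exists>z. \<forall>x\<in>dom A. cinner (the (A x)) y = cinner x z
     then Some (THE z. \<forall>x\<in>dom A. cinner (the (A x)) y = cinner x z) else None)"

definition bounded_clinear :: "('a::complex_inner \<Rightarrow> 'a) \<Rightarrow> bool" where
  "bounded_clinear f \<longleftrightarrow> bounded_linear f \<and> (\<forall>c x. f (c *\<^sub>C x) = c *\<^sub>C f x)"

definition resolvent_set :: "'a::complex_inner operator \<Rightarrow> complex set" where
  "resolvent_set A = {l. let R = (\<lambda>x. the (op_add (op_scale l Some) (op_scale (-1) A) x)) in
     bij_betw R (dom A) UNIV \<and> bounded_clinear (inv_into (dom A) R)}"

definition op_spectrum :: "'a::complex_inner operator \<Rightarrow> complex set" where
  "op_spectrum A = - resolvent_set A"

lemma dom_op_scale [simp]: "dom (op_scale c A) = dom A"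
  by (auto simp: op_scale_def)

lemma dom_op_add [simp]: "dom (op_add A B) = dom A \<inter> dom B"
  by (auto simp: op_add_def split: if_splits)

lemma dom_op_power_Suc: "dom (op_power A (Suc k)) \<subseteq> dom (op_power A k)"
  by (auto simp: map_comp_def split: option.splits)

lemma dom_op_poly: "dom (op_poly p A) = dom (op_power A (degree p))"
proof -
  have "dom (op_poly_upto p A k) = dom (op_power A k)" for k
  proof (induction k)
    case 0
    show ?case by simp
  next
    case (Suc k)
    then show ?case
      using dom_op_power_Suc[of A k] by (simp del: op_power.simps) blast
  qed
  then show ?thesis by (simp add: op_poly_def)
qed

lemma op_poly_upto_apply:
  "x \<in> dom (op_power A k) \<Longrightarrow>
     op_poly_upto p A k x = Some (\<Sum>i\<le>k. coeff p i *\<^sub>C the (op_power A i x))"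
proof (induction k)
  case 0
  show ?case by (simp add: op_scale_def)
next
  case (Suc k)
  from Suc.prems have "x \<in> dom (op_power A k)" using dom_op_power_Suc by blast
  with Suc.IH have "op_poly_upto p A k x = Some (\<Sum>i\<le>k. coeff p i *\<^sub>C the (op_power A i x))" .
  moreover obtain y where "op_power A (Suc k) x = Some y" using Suc.prems by blast
  ultimately show ?case
    by (auto simp: op_add_def op_scale_def add.commute simp del: op_power.simps)
qed

lemma op_poly_apply:
  "x \<in> dom (op_power A (degree p)) \<Longrightarrow>
     op_poly p A x = Some (\<Sum>i\<le>degree p. coeff p i *\<^sub>C the (op_power A i x))"
  by (simp add: op_poly_def op_poly_upto_apply)

lemma op_adjoint_eq_Some_iff:
  fixes A :: "'a::complex_inner operator"
  assumes "densely_defined A"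
  shows "op_adjoint A y = Some z \<longleftrightarrow> (\<forall>x\<in>dom A. cinner (the (A x)) y = cinner x z)"
proof -
  have uniq: "z = w" if "\<forall>x\<in>dom A. cinner (the (A x)) y = cinner x z"
    and "\<forall>x\<in>dom A. cinner (the (A x)) y = cinner x w" for z w
  proof -
    have "dom A \<subseteq> {x. inner x (z - w) = 0}"
    proof
      fix x
      assume "x \<in> dom A"
      then have "cinner x z = cinner x w" using that by metis
      then have "inner x z = inner x w" by (simp add: inner_eq_Re_cinner)
      then show "x \<in> {x. inner x (z - w) = 0}" by (simp add: inner_diff_right)
    qed
    moreover have "closed {x. inner x (z - w) = 0}"
      by (intro closed_Collect_eq continuous_intros)
    ultimately have "closure (dom A) \<subseteq> {x. inner x (z - w) = 0}"
      by (rule closure_minimal)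
    then have "inner (z - w) (z - w) = 0"
      using assms unfolding densely_defined_def by blast
    then show ?thesis by simp
  qed
  show ?thesis
  proof
    assume *: "op_adjoint A y = Some z"
    then have ex: "\<exists>z. \<forall>x\<in>dom A. cinner (the (A x)) y = cinner x z"
      unfolding op_adjoint_def by (metis option.distinct(1))
    then have "\<exists>!z. \<forall>x\<in>dom A. cinner (the (A x)) y = cinner x z" using uniq by blast
    from theI'[OF this] * ex show "\<forall>x\<in>dom A. cinner (the (A x)) y = cinner x z"
      unfolding op_adjoint_def by (metis (no_types, lifting) option.inject)
  next
    assume *: "\<forall>x\<in>dom A. cinner (the (A x)) y = cinner x z"
    then have "(THE z. \<forall>x\<in>dom A. cinner (the (A x)) y = cinner x z) = z"
      using uniq by (intro the_equality) blast+
    with * show "op_adjoint A y = Some z" unfolding op_adjoint_def by auto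
  qed
qed

end

theory Submission
  imports Defs
begin

text \<open>Write \<open>B = (l I - p(T))\<^sup>-\<^sup>1\<close> for a point \<open>l\<close> of the resolvent set. Since \<open>T\<close> is closable, the closed
  graph theorem makes \<open>T\<^sup>k B\<close> bounded for every \<open>k \<le> n\<close>, so that it has an everywhere defined
  adjoint. Moreover \<open>B T x = T B x\<close> for \<open>x \<in> D(T)\<close>: the leading coefficient of \<open>p\<close> is nonzero and
  \<open>l B x - p(T) B x = x \<in> D(T)\<close>, whence \<open>B x \<in> D(T\<^sup>n\<^sup>+\<^sup>1)\<close>. If now \<open>y\<close> lies in the domain of the
  adjoint of \<open>p(T)\<close> and \<open>z = (l I - p(T))\<^sup>* y\<close>, then \<open>(T\<^sup>*)\<^sup>k y = (T\<^sup>k B)\<^sup>* z\<close> by induction on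
  \<open>k \<le> n\<close>, so \<open>y \<in> D((T\<^sup>*)\<^sup>n)\<close>. The other inclusion of domains always holds.\<close>

subsection \<open>The closed graph theorem\<close>

text \<open>Baire category half of the closed graph theorem: the sublevel sets of
  \<open>norm (S x)\<close> cover the space, so one of them is dense in some ball, and linearity
  carries this density to a ball about 0 and then to every scale.\<close>

lemma linear_approx_bounded_preimage:
  fixes S :: "'a::banach \<Rightarrow> 'b::banach"
  assumes lin: "linear S"
  obtains C where "C \<ge> 0" "\<And>x e. e > 0 \<Longrightarrow> \<exists>a. norm (x - a) < e \<and> norm (S a) \<le> C * norm x"
proof -
  define E where "E k = {x. norm (S x) \<le> real k}" for k :: nat
  have "\<exists>k. interior (closure (E k)) \<noteq> {}"
  proof (rule ccontr)
    assume "\<not> ?thesis"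
    then have "euclidean interior_of \<Union>(range (\<lambda>k. closure (E k))) = {}"
      by (intro Baire_category_alt disjI1 completely_metrizable_space_euclidean) auto
    moreover have "\<Union>(range (\<lambda>k. closure (E k))) = UNIV"
    proof -
      have "x \<in> closure (E (nat \<lceil>norm (S x)\<rceil>))" for x
      proof -
        have "x \<in> E (nat \<lceil>norm (S x)\<rceil>)" by (simp add: E_def real_nat_ceiling_ge)
        then show ?thesis using closure_subset by blast
      qed
      then show ?thesis by blast
    qed
    ultimately show False by simp
  qed
  then obtain k x0 where "x0 \<in> interior (closure (E k))" by blast
  then obtain r where r: "r > 0" "ball x0 r \<subseteq> closure (E k)"
    by (meson mem_interior)
  \<comment> \<open>The ball is recentred at 0: \<open>u\<close> is half of
    \<open>(x0 + u) - (x0 - u)\<close>, and half the difference of two points of \<open>E k\<close>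
    stays in \<open>E k\<close>.\<close>
  have near: "\<exists>a\<in>E k. norm (u - a) < e" if u: "norm u < r" and e: "e > 0" for u e
  proof -
    have "x0 + u \<in> closure (E k)" "x0 - u \<in> closure (E k)"
      using r u by (auto intro!: subsetD[OF r(2)] simp: dist_norm)
    then obtain a b where ab: "a \<in> E k" "dist a (x0 + u) < e" "b \<in> E k" "dist b (x0 - u) < e"
      using e unfolding closure_approachable by blast
    have "norm (S a - S b) \<le> 2 * real k"
      using ab norm_triangle_ineq4[of "S a" "S b"] by (simp add: E_def)
    then have "(1/2) *\<^sub>R (a - b) \<in> E k"
      by (simp add: E_def linear_diff[OF lin] linear_scale[OF lin])
    moreover have "norm (u - (1/2) *\<^sub>R (a - b)) < e"
    proof -
      have "u - (1/2) *\<^sub>R (a - b) = (1/2) *\<^sub>R ((b - (x0 - u)) - (a - (x0 + u)))"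
        by (simp add: algebra_simps flip: scaleR_add_left)
      moreover have "norm ((b - (x0 - u)) - (a - (x0 + u))) < 2 * e"
        using norm_triangle_ineq4[of "b - (x0 - u)" "a - (x0 + u)"] ab(2,4)
        by (simp add: dist_norm)
      ultimately show ?thesis by simp
    qed
    ultimately show ?thesis by blast
  qed
  show ?thesis
  proof
    show "0 \<le> 2 * real k / r" using r by simp
    fix x :: 'a and e :: real
    assume e: "e > 0"
    show "\<exists>a. norm (x - a) < e \<and> norm (S a) \<le> 2 * real k / r * norm x"
    proof (cases "x = 0")
      case True
      then show ?thesis using e by (intro exI[of _ 0]) (simp add: linear_0[OF lin])
    next
      case False
      \<comment> \<open>Dividing by \<open>t\<close> shrinks \<open>x\<close> to norm
        \<open>r / 2\<close>, strictly inside the ball; the precision \<open>e / t\<close> becomes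
        \<open>e\<close> after scaling back, and \<open>t * k\<close> gives the constant
        \<open>2 * k / r\<close>.\<close>
      define t where "t = 2 * norm x / r"
      have t: "t > 0" using False r by (simp add: t_def)
      have "norm ((1/t) *\<^sub>R x) < r" using False r t by (simp add: t_def)
      from near[OF this, of "e / t"] obtain a
        where a: "a \<in> E k" "norm ((1/t) *\<^sub>R x - a) < e / t" using e t by auto
      have "x - t *\<^sub>R a = t *\<^sub>R ((1/t) *\<^sub>R x - a)"
        using t by (simp add: algebra_simps)
      then have "norm (x - t *\<^sub>R a) = t * norm ((1/t) *\<^sub>R x - a)"
        using t by simp
      also have "\<dots> < e" using a(2) t by (simp add: field_simps)
      finally have "norm (x - t *\<^sub>R a) < e" .
      moreover have "norm (S (t *\<^sub>R a)) \<le> 2 * real k / r * norm x"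
      proof -
        have "norm (S (t *\<^sub>R a)) = t * norm (S a)" using t by (simp add: linear_scale[OF lin])
        also have "\<dots> \<le> t * real k" using a(1) t by (simp add: E_def)
        finally show ?thesis by (simp add: t_def mult_ac)
      qed
      ultimately show ?thesis by blast
    qed
  qed
qed

text \<open>Successive approximation: \<open>x\<close> is the sum of corrections \<open>a j\<close>
  whose images decay geometrically. The images therefore have a convergent sum, and the closed graph
  identifies it with \<open>S x\<close>.\<close>

theorem closed_graph_bounded_linear:
  fixes S :: "'a::banach \<Rightarrow> 'b::banach"
  assumes lin: "linear S"
    and graph: "\<And>X x y. X \<longlonglongrightarrow> x \<Longrightarrow> (\<lambda>k. S (X k)) \<longlonglongrightarrow> y \<Longrightarrow> S x = y"
  shows "bounded_linear S"
proof -
  obtain C where C: "C \<ge> 0"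
    and ex: "\<And>x e. e > 0 \<Longrightarrow> \<exists>a. norm (x - a) < e \<and> norm (S a) \<le> C * norm x"
    using linear_approx_bounded_preimage[OF lin] by blast
  have bound: "norm (S x) \<le> norm x * (2 * C)" for x
  proof (cases "x = 0")
    case True
    then show ?thesis by (simp add: linear_0[OF lin])
  next
    case False
    define g where "g u e = (SOME a. norm (u - a) < e \<and> norm (S a) \<le> C * norm u)" for u e
    have g: "norm (u - g u e) < e \<and> norm (S (g u e)) \<le> C * norm u" if "e > 0" for u e
      unfolding g_def by (rule someI_ex) (rule ex[OF that])
    \<comment> \<open>\<open>X j\<close> is the remainder after \<open>j\<close> corrections. The
      tolerance at stage \<open>j\<close> carries the exponent \<open>Suc j\<close>, so each choice
      bounds the next remainder directly and \<open>nX\<close> needs only a case split.\<close>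
    define X where "X = rec_nat x (\<lambda>j u. u - g u (norm x * (1/2) ^ Suc j))"
    define a where "a j = g (X j) (norm x * (1/2) ^ Suc j)" for j
    have X0: "X 0 = x" and XSuc: "X (Suc j) = X j - a j" for j
      by (simp_all add: X_def a_def)
    have pos: "norm x * (1/2) ^ Suc j > 0" for j using False by simp
    have nX: "norm (X j) \<le> norm x * (1/2) ^ j" for j
    proof (cases j)
      case 0
      then show ?thesis by (simp add: X0)
    next
      case (Suc i)
      then show ?thesis using g[OF pos[of i], of "X i"] by (simp add: XSuc a_def)
    qed
    have na: "norm (S (a j)) \<le> C * norm x * (1/2) ^ j" for j
    proof -
      have "norm (S (a j)) \<le> C * norm (X j)" unfolding a_def using g[OF pos] by blast
      also have "\<dots> \<le> C * (norm x * (1/2) ^ j)" using nX C by (intro mult_left_mono)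
      finally show ?thesis by (simp add: mult_ac)
    qed
    have geo: "(\<lambda>j. C * norm x * (1/2) ^ j) sums (C * norm x * 2)"
      using sums_mult[OF geometric_sums[of "1/2::real"], of "C * norm x"] by simp
    have sumn: "summable (\<lambda>j. norm (S (a j)))"
      by (rule summable_comparison_test'[OF sums_summable[OF geo], of 0]) (use na in simp)
    then have summ: "summable (\<lambda>j. S (a j))" by (rule summable_norm_cancel)
    have part: "(\<Sum>j<m. a j) = x - X m" for m
      by (induction m) (simp_all add: X0 XSuc)
    have "X \<longlonglongrightarrow> 0"
    proof (rule Lim_null_comparison)
      show "\<forall>\<^sub>F j in sequentially. norm (X j) \<le> norm x * (1/2) ^ j" using nX by simp
      show "(\<lambda>j. norm x * (1/2) ^ j) \<longlonglongrightarrow> 0"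
        by (intro tendsto_mult_right_zero LIMSEQ_power_zero) simp
    qed
    then have "(\<lambda>m. x - X m) \<longlonglongrightarrow> x - 0" by (intro tendsto_intros)
    then have "(\<lambda>m. \<Sum>j<m. a j) \<longlonglongrightarrow> x" by (simp add: part)
    moreover have "(\<lambda>m. S (\<Sum>j<m. a j)) \<longlonglongrightarrow> (\<Sum>j. S (a j))"
      using summable_LIMSEQ[OF summ] by (simp add: linear_sum[OF lin])
    ultimately have "S x = (\<Sum>j. S (a j))" by (rule graph)
    also have "norm \<dots> \<le> (\<Sum>j. norm (S (a j)))" by (rule summable_norm[OF sumn])
    also have "\<dots> \<le> (\<Sum>j. C * norm x * (1/2) ^ j)"
      using na by (intro suminf_le sumn sums_summable[OF geo])
    also have "\<dots> = norm x * (2 * C)" using sums_unique[OF geo] by (simp only: mult_ac)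
    finally show ?thesis .
  qed
  show ?thesis
    using lin bound unfolding bounded_linear_def bounded_linear_axioms_def by blast
qed

subsection \<open>The Riesz representation theorem\<close>

lemma quadratic_nonneg_imp_linear_zero:
  fixes a b :: real
  assumes "\<And>t. 0 \<le> t * b + t\<^sup>2 * a"
  shows "b = 0"
proof (rule ccontr)
  assume b: "b \<noteq> 0"
  \<comment> \<open>At \<open>t = - b / s\<close> the linear term gives
    \<open>- b\<^sup>2 / s\<close>, and \<open>s > a\<close> keeps the quadratic term from
    compensating it.\<close>
  define s where "s = \<bar>a\<bar> + 1"
  have s: "s > 0" "a < s" by (auto simp: s_def)
  have "(- b / s) * b + (- b / s)\<^sup>2 * a = b\<^sup>2 / s\<^sup>2 * (a - s)"
    using s by (simp add: field_simps power2_eq_square)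
  moreover have "b\<^sup>2 / s\<^sup>2 * (a - s) < 0"
    using b s by (intro mult_pos_neg) auto
  ultimately show False using assms[of "- b / s"] by simp
qed

text \<open>The representing vector is the minimiser of the functional \<open>J\<close>:
  completeness and the parallelogram law yield the minimiser, and its vanishing first variation is
  the claim.\<close>

theorem riesz_representation:
  fixes f :: "'a::{real_inner,complete_space} \<Rightarrow> real"
  assumes f: "bounded_linear f"
  shows "\<exists>z. \<forall>x. f x = inner x z"
proof -
  interpret f: bounded_linear f by (rule f)
  define J where "J x = (norm x)\<^sup>2 - 2 * f x" for x
  obtain K where K: "\<And>x. norm (f x) \<le> norm x * K" using f.bounded by blast
  \<comment> \<open>Completing the square in \<open>norm x\<close> bounds \<open>J\<close> from
    below.\<close>
  have "- K\<^sup>2 \<le> J x" for x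
  proof -
    have "f x \<le> norm x * K" using K[of x] by simp
    moreover have "0 \<le> (norm x - K)\<^sup>2" by simp
    ultimately show ?thesis by (simp add: J_def power2_eq_square algebra_simps)
  qed
  then have bdd: "bdd_below (range J)" by (auto intro!: bdd_belowI[of _ "- K\<^sup>2"])
  define m where "m = Inf (range J)"
  have m: "m \<le> J x" for x unfolding m_def by (rule cInf_lower) (auto simp: bdd)
  have "\<exists>x. J x < m + 1 / real (Suc k)" for k
  proof -
    have "m < m + 1 / real (Suc k)" by simp
    then show ?thesis unfolding m_def using cInf_lessD[of "range J"] by blast
  qed
  then obtain X where X: "\<And>k. J (X k) < m + 1 / real (Suc k)" by metis
  \<comment> \<open>Parallelogram law; the contributions of \<open>f\<close> cancel by linearity. As
    \<open>J\<close> at the midpoint is at least \<open>m\<close>, a minimising sequence is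
    Cauchy.\<close>
  have par: "(norm (a - b))\<^sup>2 = 2 * J a + 2 * J b - 4 * J ((1/2) *\<^sub>R (a + b))" for a b
    by (simp add: J_def f.scaleR f.add power2_norm_eq_inner inner_commute algebra_simps)
  have "Cauchy X"
  proof (rule metric_CauchyI)
    fix e :: real
    assume e: "e > 0"
    then obtain N where N: "1 / real (Suc N) < e\<^sup>2 / 4"
      using nat_approx_posE[of "e\<^sup>2 / 4"] by auto
    have "dist (X i) (X j) < e" if "i \<ge> N" "j \<ge> N" for i j
    proof -
      have small: "1 / real (Suc i) \<le> 1 / real (Suc N)" "1 / real (Suc j) \<le> 1 / real (Suc N)"
        using that by (auto intro!: divide_left_mono)
      have "(norm (X i - X j))\<^sup>2 < 2 * (1 / real (Suc i)) + 2 * (1 / real (Suc j))"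
        unfolding par using X[of i] X[of j] m[of "(1/2) *\<^sub>R (X i + X j)"] by argo
      also have "\<dots> < e\<^sup>2" using small N by linarith
      finally show ?thesis using e by (simp add: dist_norm power2_less_imp_less)
    qed
    then show "\<exists>N. \<forall>i\<ge>N. \<forall>j\<ge>N. dist (X i) (X j) < e" by blast
  qed
  then obtain z where z: "X \<longlonglongrightarrow> z" using Cauchy_convergent convergent_def by blast
  have "(\<lambda>k. J (X k)) \<longlonglongrightarrow> J z"
    unfolding J_def by (intro tendsto_intros z f.tendsto)
  moreover have "(\<lambda>k. m + 1 / real (Suc k)) \<longlonglongrightarrow> m + 0"
    by (intro tendsto_intros LIMSEQ_Suc lim_1_over_n)
  ultimately have Jz: "J z \<le> m"
    using LIMSEQ_le[of "\<lambda>k. J (X k)" "J z" "\<lambda>k. m + 1 / real (Suc k)" "m + 0"] X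
    by (simp add: less_imp_le)
  have "f x = inner x z" for x
  proof -
    \<comment> \<open>Expansion of \<open>J z \<le> m \<le> J (z + t x)\<close> in powers of
      \<open>t\<close>.\<close>
    have "0 \<le> t * (2 * inner x z - 2 * f x) + t\<^sup>2 * (inner x x)" for t
    proof -
      have "J (z + t *\<^sub>R x) = J z + (t * (2 * inner x z - 2 * f x) + t\<^sup>2 * (inner x x))"
        unfolding J_def power2_norm_eq_inner
        by (simp add: f.scaleR f.add inner_add_left inner_add_right inner_commute[of z x]
            algebra_simps power2_eq_square)
      then show ?thesis using m[of "z + t *\<^sub>R x"] Jz by simp
    qed
    then have "2 * inner x z - 2 * f x = 0" by (rule quadratic_nonneg_imp_linear_zero)
    then show ?thesis by simp
  qed
  then show ?thesis by blast
qed

subsection \<open>Complex inner product spaces\<close>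

instance chilbert_space \<subseteq> banach ..

lemma scaleC_minus_one: "(-1) *\<^sub>C x = - (x::'a::complex_inner)"
  using scaleR_eq_scaleC[of "-1" x] by simp

lemma scaleC_one [simp]: "1 *\<^sub>C x = (x::'a::complex_inner)"
  using scaleR_eq_scaleC[of 1 x] by simp

lemma cinner_zero_left [simp]: "cinner 0 (y::'a::complex_inner) = 0"
  using cinner_add_left[of 0 0 y] by simp

lemma cinner_sum_left: "cinner (\<Sum>i\<in>I. f i) (y::'a::complex_inner) = (\<Sum>i\<in>I. cinner (f i) y)"
  by (induction I rule: infinite_finite_induct) (simp_all add: cinner_add_left)

lemma cinner_scaleC_right: "cinner x (c *\<^sub>C (y::'a::complex_inner)) = cnj c * cinner x y"
  by (metis cinner_commute cinner_scaleC_left complex_cnj_mult)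

lemma cinner_sum_right: "cinner (y::'a::complex_inner) (\<Sum>i\<in>I. f i) = (\<Sum>i\<in>I. cinner y (f i))"
  by (subst cinner_commute) (simp add: cinner_sum_left cinner_commute[of y])

lemma cinner_diff_left: "cinner (x - y) (z::'a::complex_inner) = cinner x z - cinner y z"
  using cinner_add_left[of "x - y" y z] by simp

lemma cinner_diff_right: "cinner (z::'a::complex_inner) (x - y) = cinner z x - cinner z y"
  by (subst cinner_commute) (simp add: cinner_diff_left cinner_commute[of z])

lemma cinner_eqI:
  fixes y z :: "'a::complex_inner"
  assumes "\<And>u. cinner u y = cinner u z"
  shows "y = z"
proof -
  have "inner (y - z) y = inner (y - z) z" using assms by (simp add: inner_eq_Re_cinner)
  then have "inner (y - z) (y - z) = 0" by (simp add: inner_diff_right)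
  then show ?thesis by simp
qed

text \<open>Real Riesz representation settles the real parts; complex homogeneity of
  \<open>S\<close> recovers the imaginary parts by testing at
  \<open>\<i> *\<^sub>C u\<close>.\<close>

lemma bounded_clinear_adjoint_exists:
  fixes S :: "'a::chilbert_space \<Rightarrow> 'a"
  assumes "bounded_clinear S"
  shows "\<exists>z. \<forall>u. cinner (S u) w = cinner u z"
proof -
  have bl: "bounded_linear S" and hom: "\<And>c x. S (c *\<^sub>C x) = c *\<^sub>C S x"
    using assms by (auto simp: bounded_clinear_def)
  have "bounded_linear (\<lambda>u. inner (S u) w)"
    by (rule bounded_linear_compose[OF bounded_linear_inner_left bl])
  from riesz_representation[OF this] obtain z where z: "\<And>u. inner (S u) w = inner u z" by blast
  have "cinner (S u) w = cinner u z" for u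
  proof (rule complex_eqI)
    show "Re (cinner (S u) w) = Re (cinner u z)" using z[of u] by (simp add: inner_eq_Re_cinner)
    show "Im (cinner (S u) w) = Im (cinner u z)"
      using z[of "\<i> *\<^sub>C u"] by (simp add: inner_eq_Re_cinner hom cinner_scaleC_left)
  qed
  then show ?thesis by blast
qed

subsection \<open>Linear operators and their powers\<close>

lemma op_linear_zero_dom: "op_linear A \<Longrightarrow> 0 \<in> dom A"
  by (simp add: op_linear_def)

lemma op_linear_add:
  "op_linear A \<Longrightarrow> x \<in> dom A \<Longrightarrow> y \<in> dom A \<Longrightarrow> A (x + y) = Some (the (A x) + the (A y))"
  by (simp add: op_linear_def)

lemma op_linear_scaleC:
  "op_linear A \<Longrightarrow> x \<in> dom A \<Longrightarrow> A (c *\<^sub>C x) = Some (c *\<^sub>C the (A x))"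
  by (simp add: op_linear_def)

lemma op_linear_zero: "op_linear A \<Longrightarrow> A 0 = Some 0"
  using op_linear_add[of A 0 0] op_linear_zero_dom[of A] by auto

lemma op_linear_diff:
  assumes "op_linear A" "x \<in> dom A" "y \<in> dom A"
  shows "A (x - y) = Some (the (A x) - the (A y))"
proof -
  have "A (- y) = Some (- the (A y))"
    using op_linear_scaleC[OF assms(1,3), of "-1"] by (simp add: scaleC_minus_one)
  then show ?thesis using op_linear_add[OF assms(1,2), of "- y"] by auto
qed

lemma op_linear_sum:
  assumes "op_linear A" "\<And>i. i \<in> I \<Longrightarrow> f i \<in> dom A"
  shows "A (\<Sum>i\<in>I. c i *\<^sub>C f i) = Some (\<Sum>i\<in>I. c i *\<^sub>C the (A (f i)))"
  using assms(2)
proof (induction I rule: infinite_finite_induct)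
  case (insert i I)
  have "A (c i *\<^sub>C f i) = Some (c i *\<^sub>C the (A (f i)))"
    using insert.prems by (intro op_linear_scaleC assms(1)) auto
  moreover have "A (\<Sum>i\<in>I. c i *\<^sub>C f i) = Some (\<Sum>i\<in>I. c i *\<^sub>C the (A (f i)))"
    using insert by auto
  ultimately show ?case
    using insert op_linear_add[OF assms(1), of "c i *\<^sub>C f i" "\<Sum>i\<in>I. c i *\<^sub>C f i"] by auto
qed (simp_all add: op_linear_zero[OF assms(1)])

lemma op_linear_power:
  assumes "op_linear A"
  shows "op_linear (op_power A k)"
proof (induction k)
  case 0
  show ?case by (simp add: op_linear_def)
next
  case (Suc k)
  note lin = op_linear_add[OF assms] op_linear_scaleC[OF assms]
    op_linear_add[OF Suc] op_linear_scaleC[OF Suc]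
  show ?case
    unfolding op_linear_def
  proof (intro conjI ballI allI)
    show "0 \<in> dom (op_power A (Suc k))"
      using op_linear_zero[OF Suc] op_linear_zero[OF assms] by auto
  next
    fix x y
    assume "x \<in> dom (op_power A (Suc k))" "y \<in> dom (op_power A (Suc k))"
    then obtain x' x'' y' y'' where "op_power A k x = Some x'" "A x' = Some x''"
      "op_power A k y = Some y'" "A y' = Some y''"
      by (auto simp: map_comp_Some_iff)
    moreover from this have "op_power A k (x + y) = Some (x' + y')" "A (x' + y') = Some (x'' + y'')"
      using op_linear_add[OF Suc, of x y] op_linear_add[OF assms, of x' y'] by auto
    ultimately show "op_power A (Suc k) (x + y) =
        Some (the (op_power A (Suc k) x) + the (op_power A (Suc k) y))"
      by simp
  next
    fix c x
    assume "x \<in> dom (op_power A (Suc k))"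
    then obtain x' x'' where "op_power A k x = Some x'" "A x' = Some x''"
      by (auto simp: map_comp_Some_iff)
    moreover from this have "op_power A k (c *\<^sub>C x) = Some (c *\<^sub>C x')"
      "A (c *\<^sub>C x') = Some (c *\<^sub>C x'')"
      using op_linear_scaleC[OF Suc, of x c] op_linear_scaleC[OF assms, of x' c] by auto
    ultimately show "op_power A (Suc k) (c *\<^sub>C x) = Some (c *\<^sub>C the (op_power A (Suc k) x))"
      by simp
  qed
qed

lemma dom_op_power_mono: "i \<le> k \<Longrightarrow> dom (op_power A k) \<subseteq> dom (op_power A i)"
  by (rule lift_Suc_antimono_le[of "\<lambda>k. dom (op_power A k)"]) (rule dom_op_power_Suc)

text \<open>The recursion peels a factor off on the left; peeling on the right, with equal domains,
  is what adjoints and commutation call for.\<close>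

lemma op_power_Suc_right: "op_power A (Suc k) = op_power A k \<circ>\<^sub>m A"
proof (induction k)
  case 0
  show ?case by (rule ext) (simp add: map_comp_def split: option.split)
next
  case (Suc k)
  have "op_power A (Suc (Suc k)) = A \<circ>\<^sub>m (op_power A k \<circ>\<^sub>m A)"
    using Suc by simp
  also have "\<dots> = op_power A (Suc k) \<circ>\<^sub>m A"
    by (rule ext) (simp add: map_comp_def split: option.split)
  finally show ?case .
qed

lemma op_power_Suc_apply:
  assumes "x \<in> dom (op_power A (Suc k))"
  shows "the (op_power A k x) \<in> dom A"
    and "op_power A (Suc k) x = A (the (op_power A k x))"
  using assms by (auto simp: map_comp_Some_iff)

text \<open>The outermost factor on \<open>x\<close> moves first and becomes the innermost one on
  \<open>y\<close>. Hence the induction generalises \<open>y\<close> and peels the adjoint power on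
  the right.\<close>

lemma cinner_op_power_adjoint:
  assumes dd: "densely_defined A"
    and "x \<in> dom (op_power A k)" "y \<in> dom (op_power (op_adjoint A) k)"
  shows "cinner (the (op_power A k x)) y = cinner x (the (op_power (op_adjoint A) k y))"
  using assms(2,3)
proof (induction k arbitrary: y)
  case 0
  then show ?case by simp
next
  case (Suc k)
  obtain w where w: "op_adjoint A y = Some w" "w \<in> dom (op_power (op_adjoint A) k)"
    and e: "op_power (op_adjoint A) (Suc k) y = op_power (op_adjoint A) k w"
    using Suc.prems(2) unfolding op_power_Suc_right by (force simp: map_comp_Some_iff)
  note x = op_power_Suc_apply[OF Suc.prems(1)]
  have "cinner (the (op_power A (Suc k) x)) y = cinner (the (op_power A k x)) w"
    unfolding x(2) using w(1) x(1) op_adjoint_eq_Some_iff[OF dd] by blast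
  also have "\<dots> = cinner x (the (op_power (op_adjoint A) k w))"
    using Suc.IH[OF _ w(2)] Suc.prems(1) dom_op_power_Suc by blast
  finally show ?case by (simp only: e)
qed

text \<open>The limit pair lies in the graph of a closed extension, which agrees with
  \<open>A\<close> at \<open>x\<close>. The graph of \<open>A\<close> itself may fail to be closed,
  so \<open>x \<in> dom A\<close> is assumed.\<close>

lemma op_closable_limit:
  assumes "op_closable A" "x \<in> dom A"
    and "\<And>k. X k \<in> dom A" "X \<longlonglongrightarrow> x" "(\<lambda>k. the (A (X k))) \<longlonglongrightarrow> w"
  shows "the (A x) = w"
proof -
  obtain C where C: "closed (Map.graph C)" "A \<subseteq>\<^sub>m C"
    using assms(1) by (auto simp: op_closable_def op_closed_def)
  have ext: "C u = Some (the (A u))" if "u \<in> dom A" for u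
    using C(2) that by (force simp: map_le_def)
  have "(x, w) \<in> Map.graph C"
  proof (rule closed_sequentially[OF C(1)])
    show "(X k, the (A (X k))) \<in> Map.graph C" for k
      using ext[OF assms(3)] by (simp add: graph_def)
    show "(\<lambda>k. (X k, the (A (X k)))) \<longlonglongrightarrow> (x, w)" using assms(4,5) by (rule tendsto_Pair)
  qed
  then show ?thesis using ext[OF assms(2)] by (simp add: graph_def)
qed

text \<open>Boundedness is gained one power at a time: \<open>A \<circ> A\<^sup>k \<circ> B\<close> is everywhere defined, and its graph
  is closed because \<open>A\<close> is closable and \<open>A\<^sup>k \<circ> B\<close> is already continuous.\<close>

lemma bounded_clinear_op_power:
  fixes A :: "'a::chilbert_space operator"
  assumes lin: "op_linear A" and closable: "op_closable A"
    and B: "bounded_clinear B" "\<And>u. B u \<in> dom (op_power A k)"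
  shows "bounded_clinear (\<lambda>u. the (op_power A k (B u)))"
  using B(2)
proof (induction k)
  case 0
  then show ?case using B(1) by simp
next
  case (Suc k)
  let ?S = "\<lambda>k u. the (op_power A k (B u))"
  have IH: "bounded_clinear (?S k)" using Suc dom_op_power_Suc by blast
  have bB: "bounded_linear B" and hB: "\<And>c x. B (c *\<^sub>C x) = c *\<^sub>C B x"
    using B(1) by (auto simp: bounded_clinear_def)
  note linS = op_linear_power[OF lin, of "Suc k"]
  have hom: "?S (Suc k) (c *\<^sub>C x) = c *\<^sub>C ?S (Suc k) x" for c x
    using op_linear_scaleC[OF linS Suc.prems] by (simp add: hB del: op_power.simps)
  have "linear (?S (Suc k))"
  proof (rule linearI)
    show "?S (Suc k) (x + y) = ?S (Suc k) x + ?S (Suc k) y" for x y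
      using op_linear_add[OF linS Suc.prems Suc.prems]
      by (simp add: linear_add[OF bounded_linear.linear[OF bB]] del: op_power.simps)
    show "?S (Suc k) (r *\<^sub>R x) = r *\<^sub>R ?S (Suc k) x" for r x
      by (simp only: scaleR_eq_scaleC hom)
  qed
  moreover have "?S (Suc k) x = y"
    if "X \<longlonglongrightarrow> x" "(\<lambda>j. ?S (Suc k) (X j)) \<longlonglongrightarrow> y" for X x y
  proof -
    have "(\<lambda>j. ?S k (X j)) \<longlonglongrightarrow> ?S k x"
      using IH that(1) by (auto simp: bounded_clinear_def intro: bounded_linear.tendsto)
    then show ?thesis
      using that(2) op_closable_limit[OF closable, of "?S k x" "\<lambda>j. ?S k (X j)" y]
        op_power_Suc_apply[OF Suc.prems] by (simp del: op_power.simps)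
  qed
  ultimately have "bounded_linear (?S (Suc k))" by (rule closed_graph_bounded_linear)
  then show ?case using hom by (simp add: bounded_clinear_def)
qed

subsection \<open>Adjoints of polynomials\<close>

lemma densely_defined_op_power:
  assumes "densely_defined (op_power A n)" "n \<ge> 1"
  shows "densely_defined A"
proof -
  have "op_power A 1 = A" by (rule ext) (simp add: map_comp_def)
  then have "dom (op_power A n) \<subseteq> dom A" using dom_op_power_mono[OF assms(2), of A] by simp
  then show ?thesis
    using assms(1) closure_mono unfolding densely_defined_def by blast
qed

text \<open>Each power moves across the inner product separately; the coefficients become conjugated
  because the second argument is conjugate linear.\<close>

lemma op_poly_cnj_adjoint_le:
  fixes A :: "'a::complex_inner operator"
  assumes A: "densely_defined A" and P: "densely_defined (op_poly p A)"
  shows "op_poly (map_poly cnj p) (op_adjoint A) \<subseteq>\<^sub>m op_adjoint (op_poly p A)"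
  unfolding map_le_def
proof
  have deg: "degree (map_poly cnj p) = degree p" by (rule degree_map_poly) simp
  fix y
  assume "y \<in> dom (op_poly (map_poly cnj p) (op_adjoint A))"
  then have y: "y \<in> dom (op_power (op_adjoint A) (degree p))" by (simp add: dom_op_poly deg)
  have "cinner (the (op_poly p A x)) y =
      cinner x (\<Sum>i\<le>degree p. cnj (coeff p i) *\<^sub>C the (op_power (op_adjoint A) i y))"
    if "x \<in> dom (op_poly p A)" for x
  proof -
    have x: "x \<in> dom (op_power A (degree p))" using that by (simp add: dom_op_poly)
    have "cinner (the (op_power A i x)) y = cinner x (the (op_power (op_adjoint A) i y))"
      if "i \<le> degree p" for i
      using that x y dom_op_power_mono by (intro cinner_op_power_adjoint A) blast+
    then show ?thesis
      by (simp add: op_poly_apply[OF x] cinner_sum_left cinner_sum_right cinner_scaleC_left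
          cinner_scaleC_right)
  qed
  then have "op_adjoint (op_poly p A) y =
      Some (\<Sum>i\<le>degree p. cnj (coeff p i) *\<^sub>C the (op_power (op_adjoint A) i y))"
    using op_adjoint_eq_Some_iff[OF P] by blast
  then show "op_poly (map_poly cnj p) (op_adjoint A) y = op_adjoint (op_poly p A) y"
    using op_poly_apply[of y "op_adjoint A" "map_poly cnj p"] y by (simp add: deg coeff_map_poly)
qed

text \<open>For \<open>v = B x\<close>, with \<open>B\<close> the inverse of
  \<open>l I - p(A)\<close>, this is the commutation \<open>B A x = A B x\<close>, phrased through
  the resolvent equation: \<open>A v\<close> solves it with right-hand side
  \<open>A x\<close>.\<close>

lemma op_poly_resolvent_shift:
  assumes lin: "op_linear A" and n: "degree p \<ge> 1" and x: "x \<in> dom A"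
    and v: "v \<in> dom (op_power A (degree p))" "l *\<^sub>C v - the (op_poly p A v) = x"
  shows "v \<in> dom (op_power A (Suc (degree p)))"
    and "l *\<^sub>C the (A v) - the (op_poly p A (the (A v))) = the (A x)"
proof -
  define n where "n = degree p"
  let ?P = "\<lambda>i. the (op_power A i v)"
  have vi: "v \<in> dom (op_power A i)" if "i \<le> n" for i
    using v(1) that dom_op_power_mono unfolding n_def by blast
  have low: "?P i \<in> dom A" if "i < n" for i
    using vi[of "Suc i"] that by (intro op_power_Suc_apply) simp
  have vA: "v \<in> dom A" using low[of 0] n by (simp add: n_def)
  \<comment> \<open>All terms below the leading one lie in \<open>dom A\<close>. Solving the
    equation for the leading term and dividing by its nonzero coefficient puts
    \<open>A\<^sup>n v\<close> into \<open>dom A\<close> as well.\<close>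
  define s where "s = (\<Sum>i<n. coeff p i *\<^sub>C ?P i)"
  have s: "s \<in> dom A" using op_linear_sum[OF lin, of "{..<n}" ?P "coeff p"] low by (auto simp: s_def)
  have lv: "l *\<^sub>C v \<in> dom A" using op_linear_scaleC[OF lin vA] by blast
  have "x = l *\<^sub>C v - (s + coeff p n *\<^sub>C ?P n)"
    using v by (simp add: op_poly_apply n_def s_def flip: lessThan_Suc_atMost)
  then have "coeff p n *\<^sub>C ?P n = l *\<^sub>C v - x - s" by (simp add: algebra_simps)
  also have "\<dots> \<in> dom A"
    using op_linear_diff[OF lin] lv x s by (metis domI)
  finally have "inverse (coeff p n) *\<^sub>C coeff p n *\<^sub>C ?P n \<in> dom A"
    using op_linear_scaleC[OF lin] by blast
  moreover have "coeff p n \<noteq> 0" using n by (auto simp: n_def)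
  ultimately have top: "?P n \<in> dom A" by (simp add: scaleC_scaleC)
  then show dSuc: "v \<in> dom (op_power A (Suc (degree p)))"
    using v(1) by (auto simp: map_comp_Some_iff n_def)
  have dP: "?P i \<in> dom A" if "i \<le> n" for i using top low that by (cases "i = n") auto
  \<comment> \<open>Left and right peeling of the same power; \<open>top\<close> makes the case
    \<open>i = n\<close> defined.\<close>
  have shift: "op_power A i (the (A v)) = A (?P i)" if "i \<le> n" for i
  proof -
    have "op_power A (Suc i) v = op_power A i (the (A v))"
      unfolding op_power_Suc_right using vA by auto
    moreover have "op_power A (Suc i) v = A (?P i)" using vi[OF that] by auto
    ultimately show ?thesis by simp
  qed
  have "the (A v) \<in> dom (op_power A n)" using shift[of n] top by (auto simp: dom_def)
  then have "the (op_poly p A (the (A v))) = (\<Sum>i\<le>n. coeff p i *\<^sub>C the (A (?P i)))"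
    by (simp add: op_poly_apply n_def shift[unfolded n_def])
  moreover have sumA: "A (the (op_poly p A v)) = Some (\<Sum>i\<le>n. coeff p i *\<^sub>C the (A (?P i)))"
    using op_linear_sum[OF lin, of "{..n}" ?P "coeff p"] dP v(1) by (simp add: op_poly_apply n_def)
  \<comment> \<open>\<open>A\<close> is applied to both sides of the resolvent equation; both terms
    on its left lie in \<open>dom A\<close>.\<close>
  moreover have "the (A x) = the (A (l *\<^sub>C v)) - the (A (the (op_poly p A v)))"
    using op_linear_diff[OF lin lv, of "the (op_poly p A v)"] domI[of A, OF sumA] v(2) by simp
  ultimately show "l *\<^sub>C the (A v) - the (op_poly p A (the (A v))) = the (A x)"
    by (simp add: op_linear_scaleC[OF lin vA])
qed

theorem theorem3p1:
  fixes T :: "'a::chilbert_space operator" and p :: "complex poly" and n :: nat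
  assumes "n \<ge> 1"
    and "op_linear T"
    and "op_closable T"
    and "densely_defined (op_power T n)"
    and "degree p = n"
    and "op_spectrum (op_poly p T) \<noteq> UNIV"
  shows "op_adjoint (op_poly p T) = op_poly (map_poly cnj p) (op_adjoint T)"
proof -
  let ?P = "op_poly p T" and ?Q = "op_poly (map_poly cnj p) (op_adjoint T)"
  have dT: "densely_defined T" using densely_defined_op_power assms(1,4) by blast
  have domP: "dom ?P = dom (op_power T n)" using assms(5) by (simp add: dom_op_poly)
  then have dP: "densely_defined ?P" using assms(4) by (simp add: densely_defined_def)
  have deg: "degree (map_poly cnj p) = n" using degree_map_poly[of cnj p] assms(5) by simp
  have le: "?Q \<subseteq>\<^sub>m op_adjoint ?P" by (rule op_poly_cnj_adjoint_le[OF dT dP])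
  obtain l where "l \<in> resolvent_set ?P" using assms(6) by (auto simp: op_spectrum_def)
  define R where "R x = the (op_add (op_scale l Some) (op_scale (-1) ?P) x)" for x
  define B where "B = inv_into (dom ?P) R"
  have bij: "bij_betw R (dom ?P) UNIV" and B: "bounded_clinear B"
    using \<open>l \<in> resolvent_set ?P\<close> by (simp_all add: resolvent_set_def Let_def R_def[abs_def] B_def)
  have R: "R x = l *\<^sub>C x - the (?P x)" if "x \<in> dom ?P" for x
    using that by (auto simp: R_def op_add_def op_scale_def scaleC_minus_one)
  have Bdom: "B u \<in> dom (op_power T n)" for u
    unfolding B_def domP[symmetric] using bij by (intro inv_into_into) (simp add: bij_betw_def)
  have RB: "R (B u) = u" for u
    unfolding B_def using bij by (intro f_inv_into_f) (simp add: bij_betw_def)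
  have BR: "B (R x) = x" if "x \<in> dom ?P" for x
    unfolding B_def using bij that by (simp add: bij_betw_def)
  let ?S = "\<lambda>k u. the (op_power T k (B u))"
  \<comment> \<open>\<open>T\<^sup>k B T x = T\<^sup>k\<^sup>+\<^sup>1 B x\<close>, obtained by
    applying \<open>T\<^sup>k\<close> to \<open>B T x = T B x\<close>.\<close>
  have S_comm: "?S k (the (T x)) = ?S (Suc k) x" if x: "x \<in> dom T" and k: "k < n" for k x
  proof -
    have Bx: "B x \<in> dom (op_power T (degree p))" "l *\<^sub>C B x - the (?P (B x)) = x"
      using Bdom[of x] R[of "B x"] RB[of x] by (simp_all add: assms(5) domP)
    have n: "degree p \<ge> 1" using assms(1,5) by simp
    note comm = op_poly_resolvent_shift[OF assms(2) n x Bx]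
    have TB: "op_power T (Suc i) (B x) = op_power T i (the (T (B x)))" if "i \<le> n" for i
    proof -
      have "B x \<in> dom (op_power T (Suc i))"
        using comm(1) that dom_op_power_mono[of "Suc i" "Suc (degree p)"] assms(5) by auto
      then show ?thesis unfolding op_power_Suc_right by (auto simp: map_comp_Some_iff)
    qed
    \<comment> \<open>This uses \<open>B x \<in> D(T\<^sup>n\<^sup>+\<^sup>1)\<close>, one power
      beyond \<open>Bdom\<close>; then \<open>BR\<close> can invert \<open>R\<close> at
      \<open>T B x\<close>.\<close>
    have dTB: "the (T (B x)) \<in> dom ?P"
      using comm(1) TB[of n] unfolding domP assms(5) by (auto simp: dom_def)
    then have "R (the (T (B x))) = the (T x)" using comm(2) R by simp
    then have "B (the (T x)) = the (T (B x))" using BR[OF dTB] by simp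
    then show ?thesis using TB[of k] k by (simp del: op_power.simps)
  qed
  have "y \<in> dom ?Q" if y: "op_adjoint ?P y = Some w" for y w
  proof -
    define z where "z = cnj l *\<^sub>C y - w"
    \<comment> \<open>In operator terms, \<open>y = B\<^sup>* z\<close>.\<close>
    have "cinner u y = cinner (B u) z" for u
    proof -
      have Bu: "B u \<in> dom ?P" using Bdom by (simp add: domP)
      then have "cinner (the (?P (B u))) y = cinner (B u) w"
        using y op_adjoint_eq_Some_iff[OF dP] by blast
      then have "cinner (R (B u)) y = cinner (B u) z"
        by (simp add: R[OF Bu] z_def cinner_diff_left cinner_diff_right cinner_scaleC_left
            cinner_scaleC_right)
      then show ?thesis by (simp add: RB)
    qed
    note yz = this
    have "\<exists>z'. \<forall>u. cinner (?S k u) z = cinner u z'" if "k \<le> n" for k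
    proof (rule bounded_clinear_adjoint_exists, rule bounded_clinear_op_power[OF assms(2,3) B])
      show "B u \<in> dom (op_power T k)" for u using Bdom dom_op_power_mono[OF that] by blast
    qed
    \<comment> \<open>\<open>Z k\<close> is the vector
      \<open>(T\<^sup>k B)\<^sup>* z\<close>.\<close>
    then obtain Z where Z: "\<And>k u. k \<le> n \<Longrightarrow> cinner (?S k u) z = cinner u (Z k)" by metis
    have "op_power (op_adjoint T) k y = Some (Z k)" if "k \<le> n" for k
      using that
    proof (induction k)
      case 0
      have "y = Z 0" by (rule cinner_eqI) (use yz Z[of 0] in simp)
      then show ?case by simp
    next
      case (Suc k)
      \<comment> \<open>By \<open>S_comm\<close>, pairing \<open>T\<^sup>k B T x\<close> with
        \<open>z\<close> is pairing \<open>T\<^sup>k\<^sup>+\<^sup>1 B x\<close> with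
        \<open>z\<close>; the bound \<open>Suc k \<le> n\<close> makes both vectors
        \<open>Z k\<close> and \<open>Z (Suc k)\<close> available.\<close>
      have "cinner (the (T x)) (Z k) = cinner x (Z (Suc k))" if "x \<in> dom T" for x
        using Z[of k "the (T x)"] Z[of "Suc k" x] S_comm[OF that, of k] Suc.prems
        by (simp del: op_power.simps)
      then have "op_adjoint T (Z k) = Some (Z (Suc k))"
        using op_adjoint_eq_Some_iff[OF dT] by blast
      then show ?case using Suc by simp
    qed
    then show ?thesis by (auto simp: dom_op_poly deg)
  qed
  then have "dom (op_adjoint ?P) \<subseteq> dom ?Q" by blast
  \<comment> \<open>By \<open>le\<close> the two operators agree on \<open>dom ?Q\<close>, so
    equality of domains finishes the proof.\<close>
  then show ?thesis
    using le by (metis map_le_antisym map_le_def subsetD)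
qed

end
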